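(* Let $(L,+,\cdot)$ be a commutative incline. If $A\in L^{3\times 3}$ is a $3\times 3$ matrix over $L$, then $A^{11}\leqslant A^{5}$.
   Context: An incline is a nonempty set $L$ with two binary operations $+$ and $\cdot$ such that: (1) $(L,+)$ is a semilattice (i.e. $+$ is associative, commutative and idempotent); (2) $(L,\cdot)$ is a semigroup; (3) $x(y+z)=xy+xz$ and $(y+z)x=yx+zx$ for all $x,y,z\in L$; (4) $x+xy=x+yx=x$ for all $x,y\in L$. (No zero or identity element is assumed.) The incline is commutative if $xy=yx$ for all $x,y\in L$. The relation $x\leqslant y \Leftrightarrow x+y=y$ is a partial order on $L$. $L^{n\times n}$ denotes the set of $n\times n$ matrices over $L$. For $A=(a_{ij})$, $B=(b_{ij})\in L^{n\times n}$ the product is $AB=\left(\sum_{k=1}^{n}a_{ik}b_{kj}\right)$, and $A\leqslant B$ means $a_{ij}\leqslant b_{ij}$ for all $i,j\in\{1,\ldots,n\}$. Powers are defined by $A^1=A$ and $A^l=A^{l-1}A$ for $l\geqslant 2$. *)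

theory Defs
  imports "HOL-Analysis.Cartesian_Space"
begin

(* Class semiring provides associativity and commutativity of +, associativity of * and both
   distributive laws; it contains neither 0 nor 1. The last two axioms only define the order. *)
class incline = semiring + ord +
  assumes add_idem: "x + x = x"
    and absorb_right: "x + x * y = x"
    and absorb_left: "x + y * x = x"
    and less_eq_iff_add: "x \<le> y \<longleftrightarrow> x + y = y"
    and less_iff: "x < y \<longleftrightarrow> x \<le> y \<and> x \<noteq> y"
begin

subclass order
proof
  fix x y z :: 'a
  show "x \<le> x"
    by (simp add: less_eq_iff_add add_idem)
  show antisym: "x = y" if "x \<le> y" "y \<le> x" for x y
    using that by (metis less_eq_iff_add add.commute)
  show "x < y \<longleftrightarrow> x \<le> y \<and> \<not> y \<le> x"
    using antisym less_iff \<open>x \<le> x\<close> by blast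
  show "x \<le> z" if "x \<le> y" "y \<le> z"
    using that by (metis less_eq_iff_add add.assoc)
qed

end

class comm_incline = incline + ab_semigroup_mult

interpretation incline_add: semilattice_set "(+) :: 'a::incline \<Rightarrow> 'a \<Rightarrow> 'a"
  by unfold_locales (simp_all add: add.assoc add.commute add_idem)

(* The sum of f k over a finite nonempty set of indices k. There need not be a zero, so the library
   constant sum is not available; since + is idempotent, summing over the image f ` K agrees with
   summing the family. *)
definition incline_sum :: "('k \<Rightarrow> 'a::incline) \<Rightarrow> 'k set \<Rightarrow> 'a" where
  "incline_sum f K = semilattice_set.F (+) (f ` K)"

lemma incline_sum_singleton [simp]: "incline_sum f {k} = f k"
  by (simp add: incline_sum_def)

lemma incline_sum_insert [simp]:
  "finite K \<Longrightarrow> K \<noteq> {} \<Longrightarrow> incline_sum f (insert k K) = f k + incline_sum f K"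
  by (simp add: incline_sum_def)

(* Neither the library product ** (which requires a zero) nor * on vectors (which is componentwise). *)
definition incline_mat_mult ::
    "'a::incline ^ 'n ^ 'n \<Rightarrow> 'a ^ 'n ^ 'n \<Rightarrow> 'a ^ 'n ^ 'n"  (infixl "\<odot>" 70) where
  "A \<odot> B = (\<chi> i j. incline_sum (\<lambda>k. A $ i $ k * B $ k $ j) UNIV)"

lemma incline_mat_mult_3:
  fixes A B :: "'a::incline ^ 3 ^ 3"
  shows "(A \<odot> B) $ i $ j = A $ i $ 1 * B $ 1 $ j + A $ i $ 2 * B $ 2 $ j + A $ i $ 3 * B $ 3 $ j"
  by (simp add: incline_mat_mult_def UNIV_3 add.assoc)

(* Only positive powers have a meaning, as there is no identity matrix. *)
primrec incline_mat_pow :: "'a::incline ^ 'n ^ 'n \<Rightarrow> nat \<Rightarrow> 'a ^ 'n ^ 'n" where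
  "incline_mat_pow A 0 = undefined"
| "incline_mat_pow A (Suc l) = (if l = 0 then A else incline_mat_pow A l \<odot> A)"

end

theory Submission
  imports Defs "HOL-Library.Multiset"
begin

text \<open>
  Read \<open>A\<close> as the weights of the edges (loops included) of the complete digraph on its index set.
  Then the \<open>(i, j)\<close> entry of \<open>A ^ l\<close> is the sum over all walks of \<open>l\<close> edges from \<open>i\<close> to \<open>j\<close> of the
  product of the edge weights. Multiplication is commutative, so such a product depends only on the
  multiset of edges, and since \<open>x y \<le> x\<close>, a product grows when factors are dropped. Hence
  \<open>A ^ m \<le> A ^ n\<close> holds as soon as every walk of \<open>m\<close> edges contains, as a submultiset of its edges, a
  walk of \<open>n\<close> edges with the same ends (\<open>pow_le_pow_if_contains_walk\<close>). The edges may be traversed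
  in a new order.

  It remains to drop 6 edges from a walk of 11 edges on three vertices
  (\<open>walk_11_contains_walk_5\<close>). As long as a walk has at least 5 edges, a simple cycle can be cut out
  of it without losing a vertex. This reduces the walk to a skeleton of at most 4 edges that visits
  the same vertices, plus simple cycles, of lengths 1, 2 or 3, all of which meet the skeleton
  (\<open>skeleton\<close>). Any selection of these cycles can be spliced into the skeleton again, so it suffices
  to find cycles of total length 6 to leave out. The cycles have total length at least 7, and such a
  selection exists except when their lengths are 2, 2 and 3 (\<open>subset_sum_6\<close>). In this last case
  the skeleton has 4 edges, hence contains another cycle; this one may be cut out together with a
  suitable choice of the others, because what is kept still hangs together
  (\<open>exceptional_skeleton\<close>).
\<close>

section \<open>Walks and their edges\<close>

fun edges :: "'v list \<Rightarrow> ('v \<times> 'v) multiset" where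
  "edges (x # y # zs) = add_mset (x, y) (edges (y # zs))"
| "edges _ = {#}"

definition walks :: "'v \<Rightarrow> 'v \<Rightarrow> nat \<Rightarrow> 'v list set" where
  "walks i j n = {w. length w = Suc n \<and> hd w = i \<and> last w = j}"

lemma edges_append:
  "xs \<noteq> [] \<Longrightarrow> edges (xs @ ys) = edges xs + edges (last xs # ys)"
  by (induction xs rule: edges.induct) auto

lemma edges_eq_empty_iff: "edges w = {#} \<longleftrightarrow> length w \<le> 1"
  by (cases w rule: edges.cases) auto

lemma size_edges: "size (edges w) = length w - 1"
  by (induction w rule: edges.induct) auto

text \<open>
  A closed walk that meets \<open>w\<close> in \<open>x\<close> can be rotated so as to start at \<open>x\<close>, and then makes a detour
  that is inserted into \<open>w\<close> at an occurrence of \<open>x\<close>. Rotation does not change the edges.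
\<close>

lemma attach_cycle:
  assumes w: "w \<in> walks i j n" and c: "c \<in> walks v v m" and meet: "set w \<inter> set c \<noteq> {}"
  obtains w' where "w' \<in> walks i j (n + m)" "edges w' = edges w + edges c" "set w \<subseteq> set w'"
proof -
  obtain x where "x \<in> set w" "x \<in> set c" using meet by blast
  then obtain us vs ps qs where W: "w = us @ x # vs" and C: "c = ps @ x # qs"
    by (meson split_list)
  have ew: "edges w = edges (us @ [x]) + edges (x # vs)"
    using edges_append[of "us @ [x]" vs] by (simp add: W)
  show ?thesis
  \<comment> \<open>If \<open>ps\<close> is empty then \<open>c\<close> starts at \<open>x\<close> already; otherwise its base point, which is listed at both
    ends of \<open>c\<close>, must be listed only once in the rotated walk.\<close>
  proof (cases ps)
    case Nil
    then have "last (x # qs) = x" using c C by (auto simp: walks_def)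
    moreover have "edges (us @ x # qs @ vs) = edges (us @ [x]) + edges (x # qs @ vs)"
      using edges_append[of "us @ [x]" "qs @ vs"] by simp
    moreover have "edges (x # qs @ vs) = edges (x # qs) + edges (last (x # qs) # vs)"
      using edges_append[of "x # qs" vs] by simp
    ultimately have "edges (us @ x # qs @ vs) = edges w + edges c"
      using ew C Nil by (simp add: ac_simps)
    moreover have "us @ x # qs @ vs \<in> walks i j (n + m)"
      using w c \<open>last (x # qs) = x\<close> Nil unfolding W C walks_def
      by (cases vs; cases us) (auto split: if_splits)
    ultimately show ?thesis using that[of "us @ x # qs @ vs"] by (auto simp: W)
  next
    case (Cons y ps')
    then have l: "last (x # qs) = y" using c C by (auto simp: walks_def)
    have "edges (us @ x # qs @ ps' @ x # vs)
        = edges (us @ [x]) + edges (x # qs @ ps' @ x # vs)"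
      using edges_append[of "us @ [x]" "qs @ ps' @ x # vs"] by simp
    also have "edges (x # qs @ ps' @ x # vs) = edges (x # qs) + edges (y # ps' @ x # vs)"
      using edges_append[of "x # qs" "ps' @ x # vs"] l by simp
    also have "edges (y # ps' @ x # vs) = edges (y # ps' @ [x]) + edges (x # vs)"
      using edges_append[of "y # ps' @ [x]" vs] by simp
    finally have "edges (us @ x # qs @ ps' @ x # vs) = edges w + edges c"
      using ew edges_append[of "y # ps' @ [x]" qs] C Cons by (simp add: ac_simps)
    moreover have "us @ x # qs @ ps' @ x # vs \<in> walks i j (n + m)"
      using w c unfolding W C Cons walks_def by (cases vs; cases us) auto
    ultimately show ?thesis using that[of "us @ x # qs @ ps' @ x # vs"] by (auto simp: W)
  qed
qed

definition cycles :: "nat \<Rightarrow> 'v list set" where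
  "cycles k = {c. length c = Suc k \<and> hd c = last c \<and> distinct (tl c)}"

definition edges_list :: "'v list list \<Rightarrow> ('v \<times> 'v) multiset" where
  "edges_list cs = sum_list (map edges cs)"

lemma edges_list_simps [simp]:
  "edges_list [] = {#}"
  "edges_list (c # cs) = edges c + edges_list cs"
  "edges_list (cs @ ds) = edges_list cs + edges_list ds"
  by (simp_all add: edges_list_def)

lemma size_edges_list:
  "set cs \<subseteq> cycles k \<Longrightarrow> size (edges_list cs) = k * length cs"
  by (induction cs) (auto simp: cycles_def size_edges)

lemma attach_cycles:
  assumes "w \<in> walks i j n" "\<And>c. c \<in> set cs \<Longrightarrow> set w \<inter> set c \<noteq> {}"
    "\<And>c. c \<in> set cs \<Longrightarrow> \<exists>k. c \<in> cycles k"
  shows "\<exists>w' \<in> walks i j (n + size (edges_list cs)). edges w' = edges w + edges_list cs"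
  using assms
proof (induction cs arbitrary: w n)
  case Nil
  then show ?case by auto
next
  case (Cons c cs)
  obtain k where k: "c \<in> cycles k" using Cons.prems(3) by auto
  then have c: "c \<in> walks (hd c) (hd c) k" by (auto simp: cycles_def walks_def)
  obtain w' where w': "w' \<in> walks i j (n + k)" "edges w' = edges w + edges c" "set w \<subseteq> set w'"
    using attach_cycle[OF Cons.prems(1) c] Cons.prems(2) by auto
  have "\<exists>u \<in> walks i j (n + k + size (edges_list cs)). edges u = edges w' + edges_list cs"
    using Cons.prems(2,3) w'(3) by (intro Cons.IH w'(1)) fastforce+
  moreover have "size (edges c) = k" using k by (simp add: cycles_def size_edges)
  ultimately show ?case using w'(2) by (auto simp: ac_simps)
qed

text \<open>
  The form in which cycles are put back: \<open>w\<close> and \<open>cs\<close> are what is kept of a larger walk with edges \<open>M\<close>,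
  and the remaining edges of \<open>M\<close> are dropped.
\<close>

lemma walk_within:
  assumes "w \<in> walks i j n" "\<And>c. c \<in> set cs \<Longrightarrow> set w \<inter> set c \<noteq> {}"
    "\<And>c. c \<in> set cs \<Longrightarrow> \<exists>k. c \<in> cycles k"
    and "n + size (edges_list cs) = m" "edges w + edges_list cs \<subseteq># M"
  shows "\<exists>w' \<in> walks i j m. edges w' \<subseteq># M"
proof -
  have "\<exists>w' \<in> walks i j (n + size (edges_list cs)). edges w' = edges w + edges_list cs"
    by (rule attach_cycles) (use assms(1-3) in auto)
  then show ?thesis using assms(4,5) by metis
qed

lemma edges_cut:
  "edges (us @ v # ms @ v # vs) = edges (us @ v # vs) + edges (v # ms @ [v])"
  using edges_append[of "us @ [v]" vs] edges_append[of "us @ [v]" "ms @ v # vs"]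
    edges_append[of "v # ms @ [v]" vs] by (simp add: ac_simps)

section \<open>Walks on three vertices\<close>

text \<open>
  Six letters from an alphabet of three contain a segment \<open>v ms v\<close> with distinct letters \<open>v ms\<close> that can
  be shortened to \<open>v\<close> without losing a letter. This is clear if two neighbours are equal. Suppose that
  they are not. If two letters occurred only once, the third would fill four places with only two
  separators, and two of them would be neighbours. If just one letter occurs only once, the other
  two alternate on a stretch of at least three places on one side of it; a segment \<open>a b a\<close> there
  will do, as \<open>b\<close> occurs elsewhere. If every letter present occurs at least twice, any shortest return among
  the first four letters will do, since each letter in its interior loses one occurrence only.

  The proof lists the possible positions of the segment; that they are exhaustive is then a
  propositional fact.
\<close>

lemma removable_cycle_6:
  fixes x0 :: 3
  assumes "w = [x0, x1, x2, x3, x4, x5]"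
  shows "\<exists>us v ms vs. w = us @ v # ms @ v # vs \<and> distinct (v # ms)
    \<and> set ms \<subseteq> insert v (set us \<union> set vs)"
proof -
  have cut: ?thesis if "w = us @ v # ms @ v # vs" "distinct (v # ms)"
    "set ms \<subseteq> insert v (set us \<union> set vs)" for us v ms vs
    using that by blast
  consider "x0 = x1" | "x1 = x2" | "x2 = x3" | "x3 = x4" | "x4 = x5"
    | "x0 = x2" "x0 \<noteq> x1" "x1 \<in> {x3, x4, x5}" | "x1 = x3" "x1 \<noteq> x2" "x2 \<in> {x0, x4, x5}"
    | "x2 = x4" "x2 \<noteq> x3" "x3 \<in> {x0, x1, x5}" | "x3 = x5" "x3 \<noteq> x4" "x4 \<in> {x0, x1, x2}"
    | "x0 = x3" "distinct [x0, x1, x2]" "{x1, x2} \<subseteq> {x4, x5}"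
    | "x1 = x4" "distinct [x1, x2, x3]" "{x2, x3} \<subseteq> {x0, x5}"
    | "x2 = x5" "distinct [x2, x3, x4]" "{x3, x4} \<subseteq> {x0, x1}"
    using exhaust_3[of x0] exhaust_3[of x1] exhaust_3[of x2] exhaust_3[of x3] exhaust_3[of x4]
      exhaust_3[of x5]
    by (smt (verit) distinct.simps insert_iff empty_iff insert_subset list.set empty_subsetI)
  then show ?thesis
  proof cases
    case 1 show ?thesis by (rule cut[of "[]" x0 "[]" "[x2, x3, x4, x5]"]) (auto simp: assms 1)
  next
    case 2 show ?thesis by (rule cut[of "[x0]" x1 "[]" "[x3, x4, x5]"]) (auto simp: assms 2)
  next
    case 3 show ?thesis by (rule cut[of "[x0, x1]" x2 "[]" "[x4, x5]"]) (auto simp: assms 3)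
  next
    case 4 show ?thesis by (rule cut[of "[x0, x1, x2]" x3 "[]" "[x5]"]) (auto simp: assms 4)
  next
    case 5 show ?thesis by (rule cut[of "[x0, x1, x2, x3]" x4 "[]" "[]"]) (auto simp: assms 5)
  next
    case 6 then show ?thesis
      by (intro cut[of "[]" x0 "[x1]" "[x3, x4, x5]"]) (auto simp: assms)
  next
    case 7 then show ?thesis
      by (intro cut[of "[x0]" x1 "[x2]" "[x4, x5]"]) (auto simp: assms)
  next
    case 8 then show ?thesis
      by (intro cut[of "[x0, x1]" x2 "[x3]" "[x5]"]) (auto simp: assms)
  next
    case 9 then show ?thesis
      by (intro cut[of "[x0, x1, x2]" x3 "[x4]" "[]"]) (auto simp: assms)
  next
    case 10 then show ?thesis
      by (intro cut[of "[]" x0 "[x1, x2]" "[x4, x5]"]) (auto simp: assms)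
  next
    case 11 then show ?thesis
      by (intro cut[of "[x0]" x1 "[x2, x3]" "[x5]"]) (auto simp: assms)
  next
    case 12 then show ?thesis
      by (intro cut[of "[x0, x1]" x2 "[x3, x4]" "[]"]) (auto simp: assms)
  qed
qed

lemma removable_cycle:
  fixes w :: "3 list"
  assumes "6 \<le> length w"
  obtains us v ms vs where "w = us @ v # ms @ v # vs" "distinct (v # ms)"
    "set ms \<subseteq> insert v (set us \<union> set vs)"
proof -
  define p where "p = take 6 w"
  have "length p = 6" using assms by (simp add: p_def)
  then obtain x0 x1 x2 x3 x4 x5 where "p = [x0, x1, x2, x3, x4, x5]"
    by (auto simp: numeral_eq_Suc length_Suc_conv)
  then have "take 6 w = [x0, x1, x2, x3, x4, x5]" by (simp add: p_def)
  from removable_cycle_6[OF this] obtain us v ms vs where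
    *: "take 6 w = us @ v # ms @ v # vs" "distinct (v # ms)"
      "set ms \<subseteq> insert v (set us \<union> set vs)" by blast
  have "w = us @ v # ms @ v # vs @ drop 6 w"
    using *(1) append_take_drop_id[of 6 w] by simp
  then show ?thesis using that[of us v ms "vs @ drop 6 w"] * by auto
qed

text \<open>
  Cutting out cycles without losing vertices guarantees that every cycle meets whatever is left at
  the end. This is what makes the cycles independent of each other: any of them can be put back, no
  matter which others are left out. There is one list for each length because the choice
  of the cycles to leave out depends only on the lengths.
\<close>

lemma skeleton:
  fixes w :: "3 list"
  assumes "w \<in> walks i j n"
  shows "\<exists>s S C1 C2 C3. S \<in> walks i j s \<and> s \<le> 4 \<and> set S = set w
    \<and> edges w = edges S + edges_list C1 + edges_list C2 + edges_list C3
    \<and> set C1 \<subseteq> cycles 1 \<and> set C2 \<subseteq> cycles 2 \<and> set C3 \<subseteq> cycles 3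
    \<and> (\<forall>c \<in> set C1 \<union> set C2 \<union> set C3. set c \<subseteq> set w)"
  using assms
proof (induction n arbitrary: w rule: less_induct)
  case (less n)
  show ?case
  proof (cases "n \<le> 4")
    case True
    then show ?thesis
      using less.prems by (intro exI[of _ n] exI[of _ w] exI[of _ "[]"]) auto
  next
    case False
    then have "6 \<le> length w" using less.prems by (simp add: walks_def)
    then obtain us v ms vs where w: "w = us @ v # ms @ v # vs" and dist: "distinct (v # ms)"
      and ms: "set ms \<subseteq> insert v (set us \<union> set vs)"
      by (rule removable_cycle)
    define c where "c = v # ms @ [v]"
    define w' where "w' = us @ v # vs"
    have set: "set w' = set w" "set c \<subseteq> set w" using ms by (auto simp: w w'_def c_def)
    have "w' \<in> walks i j (n - Suc (length ms))"
      using less.prems by (cases us; cases vs) (auto simp: walks_def w w'_def)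
    moreover have "n - Suc (length ms) < n" using less.prems False by auto
    ultimately obtain s S C1 C2 C3 where S: "S \<in> walks i j s" "s \<le> 4" "set S = set w"
      "edges w' = edges S + edges_list C1 + edges_list C2 + edges_list C3"
      and C: "set C1 \<subseteq> cycles 1" "set C2 \<subseteq> cycles 2" "set C3 \<subseteq> cycles 3"
      "\<forall>c \<in> set C1 \<union> set C2 \<union> set C3. set c \<subseteq> set w"
      using less.IH[of "n - Suc (length ms)" w'] unfolding set by blast
    have e: "edges w = edges w' + edges c"
      using edges_cut[of us v ms vs] by (simp add: w w'_def c_def)
    have cyc: "c \<in> cycles (Suc (length ms))"
      using dist by (auto simp: c_def cycles_def)
    have "length (v # ms) \<le> CARD(3)"
      using distinct_card[OF dist] card_mono[of "UNIV :: 3 set" "set (v # ms)"] by simp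
    then consider "Suc (length ms) = 1" | "Suc (length ms) = 2" | "Suc (length ms) = 3"
      by fastforce
    then show ?thesis
    proof cases
      case 1
      show ?thesis
        using S C e cyc set(2) unfolding 1
        by (intro exI[of _ s] exI[of _ S] exI[of _ "c # C1"] exI[of _ C2] exI[of _ C3])
          (auto simp: ac_simps)
    next
      case 2
      show ?thesis
        using S C e cyc set(2) unfolding 2
        by (intro exI[of _ s] exI[of _ S] exI[of _ C1] exI[of _ "c # C2"] exI[of _ C3])
          (auto simp: ac_simps)
    next
      case 3
      show ?thesis
        using S C e cyc set(2) unfolding 3
        by (intro exI[of _ s] exI[of _ S] exI[of _ C1] exI[of _ C2] exI[of _ "c # C3"])
          (auto simp: ac_simps)
    qed
  qed
qed

text \<open>
  The numbers \<open>n1\<close>, \<open>n2\<close> and \<open>n3\<close> count the available cycles of length 1, 2 and 3.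
\<close>

lemma subset_sum_6:
  fixes n1 n2 n3 :: nat
  assumes "7 \<le> n1 + 2 * n2 + 3 * n3" "\<not> (n1 = 0 \<and> n2 = 2 \<and> n3 = 1)"
  obtains k1 k2 k3 where "k1 \<le> n1" "k2 \<le> n2" "k3 \<le> n3" "k1 + 2 * k2 + 3 * k3 = 6"
proof -
  consider "n3 \<ge> 2" | "n2 \<ge> 3" | "n1 \<ge> 6" | "n1 \<ge> 1" "n2 \<ge> 1" "n3 \<ge> 1"
    | "n1 \<ge> 2" "n2 \<ge> 2" | "n1 \<ge> 4" "n2 \<ge> 1" | "n1 \<ge> 3" "n3 \<ge> 1"
    using assms by linarith
  then show ?thesis
    by cases (use that[of 0 0 2] that[of 0 3 0] that[of 6 0 0] that[of 1 1 1]
      that[of 2 2 0] that[of 4 1 0] that[of 3 0 1] in auto)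
qed

lemma edges_list_drop: "edges_list (drop k cs) \<subseteq># edges_list cs"
  by (metis append_take_drop_id edges_list_simps(3) mset_subset_eq_add_right)

text \<open>
  Here no selection from the cycles alone has length 6, but a skeleton of 4 edges contains a cycle
  itself. If it contains a loop, the loop goes together with \<open>D2\<close> and \<open>C\<close>, and no vertex is lost.
  If its first three edges contain a cycle of length 2, this goes together with \<open>D1\<close> and \<open>D2\<close>; what
  is left meets \<open>C\<close>, which visits all vertices. Otherwise these edges form a cycle of length 3, which
  goes together with \<open>C\<close>; what is left is an edge between two different vertices, and it meets \<open>D1\<close>
  and \<open>D2\<close> because two sets of two vertices out of three always intersect.
\<close>

lemma exceptional_skeleton:
  fixes S :: "3 list"
  assumes S: "S \<in> walks i j 4" and D: "D1 \<in> cycles 2" "D2 \<in> cycles 2" and C: "C \<in> cycles 3"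
    and sub: "set C \<subseteq> set S"
  shows "\<exists>w \<in> walks i j 5. edges w \<subseteq># edges S + edges D1 + edges D2 + edges C"
    (is "\<exists>w \<in> _. _ \<subseteq># ?M")
proof -
  have "length S = 5" using S by (simp add: walks_def)
  then obtain x0 x1 x2 x3 x4 where x: "S = [x0, x1, x2, x3, x4]"
    by (auto simp: numeral_eq_Suc length_Suc_conv)
  have ij: "i = x0" "j = x4" using S by (auto simp: walks_def x)
  have cardC: "card (set (tl C)) = 3" using C by (simp add: cycles_def distinct_card)
  have "set C = UNIV"
  proof -
    have "set (tl C) = UNIV" using cardC by (intro card_subset_eq) auto
    then show ?thesis by (metis UNIV_I list.set_sel(2) subsetI subset_antisym tl_Nil top_greatest)
  qed
  then have UNIV: "set S = UNIV" and meetC: "T \<noteq> [] \<Longrightarrow> set T \<inter> set C \<noteq> {}" for T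
    using sub by auto
  have size: "size (edges D1) = 2" "size (edges D2) = 2" "size (edges C) = 3"
    using C D by (simp_all add: cycles_def size_edges)
  have le: "edges T + (edges D1 + edges D2) \<subseteq># ?M" "edges T + edges D1 \<subseteq># ?M"
    "edges T + edges C \<subseteq># ?M" if "edges T \<subseteq># edges S" for T
    using that by (auto simp: subseteq_mset_def intro: add_mono trans_le_add1)
  have attachC: ?thesis if T: "T \<in> walks i j 2" "edges T \<subseteq># edges S" for T
  proof (rule walk_within[OF T(1), of "[C]"])
    have "T \<noteq> []" using T(1) by (auto simp: walks_def)
    then show "set T \<inter> set c \<noteq> {}" if "c \<in> set [C]" for c using meetC that by simp
  qed (use C size le[OF T(2)] in auto)
  have attach1: ?thesis if T: "T \<in> walks i j 3" "edges T \<subseteq># edges S" "set T = UNIV" for T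
  proof (rule walk_within[OF T(1), of "[D1]"])
    have "D1 \<noteq> []" using D(1) by (auto simp: cycles_def)
    then show "set T \<inter> set c \<noteq> {}" if "c \<in> set [D1]" for c using T(3) that by simp
  qed (use D size le[OF T(2)] in auto)
  have attach2: ?thesis if T: "T \<in> walks i j 1" "edges T \<subseteq># edges S" "card (set T) = 2" for T
  proof (rule walk_within[OF T(1), of "[D1, D2]"])
    have "set T \<inter> set D \<noteq> {}" if D: "D \<in> cycles 2" for D
    proof
      assume "set T \<inter> set D = {}"
      then have "card (set T \<union> set D) = 2 + card (set D)"
        using T(3) by (simp add: card_Un_disjoint)
      moreover have "2 \<le> card (set D)"
        using D card_mono[of "set D" "set (tl D)"]
        by (cases D) (auto simp: cycles_def distinct_card)
      moreover have "card (set T \<union> set D) \<le> 3"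
        using card_mono[of "UNIV :: 3 set" "set T \<union> set D"] by simp
      ultimately show False by simp
    qed
    then show "set T \<inter> set c \<noteq> {}" if "c \<in> set [D1, D2]" for c using D that by auto
  qed (use D size le[OF T(2)] in auto)
  have "x0 = x3" if "distinct [x0, x1, x2]" "x3 \<notin> {x1, x2}"
    using that exhaust_3[of x0] exhaust_3[of x1] exhaust_3[of x2] exhaust_3[of x3] by auto
  then consider "x0 = x1" | "x1 = x2" | "x2 = x3" | "x3 = x4" | "x0 = x2" | "x1 = x3"
    | "x0 = x3" "x3 \<noteq> x4"
    by auto
  then show ?thesis
  proof cases
    case 1
    then show ?thesis
      using UNIV by (intro attach1[of "[x1, x2, x3, x4]"]) (auto simp: walks_def ij x)
  next
    case 2
    then show ?thesis
      using UNIV by (intro attach1[of "[x0, x2, x3, x4]"]) (auto simp: walks_def ij x)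
  next
    case 3
    then show ?thesis
      using UNIV by (intro attach1[of "[x0, x1, x3, x4]"]) (auto simp: walks_def ij x)
  next
    case 4
    then show ?thesis
      using UNIV by (intro attach1[of "[x0, x1, x2, x3]"]) (auto simp: walks_def ij x)
  next
    case 5
    then show ?thesis by (intro attachC[of "[x2, x3, x4]"]) (auto simp: walks_def ij x)
  next
    case 6
    then show ?thesis by (intro attachC[of "[x0, x3, x4]"]) (auto simp: walks_def ij x)
  next
    case 7
    then show ?thesis by (intro attach2[of "[x3, x4]"]) (auto simp: walks_def ij x)
  qed
qed

text \<open>
  With at most 4 edges in the skeleton, the cycles have total length at least 7. In the exceptional
  case of the subset sum their total length is exactly 7, so the skeleton has exactly 4 edges.
\<close>

lemma walk_11_contains_walk_5:
  fixes w :: "3 list"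
  assumes w: "w \<in> walks i j 11"
  shows "\<exists>w' \<in> walks i j 5. edges w' \<subseteq># edges w"
proof -
  obtain s S C1 C2 C3 where S: "S \<in> walks i j s" "s \<le> 4" "set S = set w"
    and e: "edges w = edges S + edges_list C1 + edges_list C2 + edges_list C3"
    and C: "set C1 \<subseteq> cycles 1" "set C2 \<subseteq> cycles 2" "set C3 \<subseteq> cycles 3"
    and sub: "\<forall>c \<in> set C1 \<union> set C2 \<union> set C3. set c \<subseteq> set w"
    using skeleton[OF w] by blast
  have "size (edges w) = 11" "size (edges S) = s" using w S(1) by (auto simp: walks_def size_edges)
  then have total: "s + length C1 + 2 * length C2 + 3 * length C3 = 11"
    using e C by (simp add: size_edges_list)
  show ?thesis
  proof (cases "length C1 = 0 \<and> length C2 = 2 \<and> length C3 = 1")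
    case True
    then obtain D1 D2 D3 where D: "C1 = []" "C2 = [D1, D2]" "C3 = [D3]"
      by (auto simp: numeral_eq_Suc length_Suc_conv)
    have "s = 4" using total True by simp
    then show ?thesis
      using exceptional_skeleton[of S i j D1 D2 D3] S C sub by (simp add: e D ac_simps)
  next
    case False
    moreover have "7 \<le> length C1 + 2 * length C2 + 3 * length C3" using total S(2) by simp
    ultimately obtain k1 k2 k3 where k: "k1 \<le> length C1" "k2 \<le> length C2" "k3 \<le> length C3"
      "k1 + 2 * k2 + 3 * k3 = 6"
      using subset_sum_6 by metis
    \<comment> \<open>the cycles that are kept\<close>
    define K where "K = drop k1 C1 @ drop k2 C2 @ drop k3 C3"
    have drops: "set (drop k1 C1) \<subseteq> cycles 1" "set (drop k2 C2) \<subseteq> cycles 2"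
      "set (drop k3 C3) \<subseteq> cycles 3"
      using C set_drop_subset by fast+
    have K: "set K \<subseteq> set C1 \<union> set C2 \<union> set C3"
      using set_drop_subset by (fastforce simp: K_def)
    show ?thesis
    proof (rule walk_within[OF S(1)])
      fix c assume "c \<in> set K"
      then have c: "c \<in> set C1 \<union> set C2 \<union> set C3" using K by blast
      then show "\<exists>k. c \<in> cycles k" using C by blast
      then have "c \<noteq> []" by (auto simp: cycles_def)
      then show "set S \<inter> set c \<noteq> {}" using c sub S(3) by (metis inf.absorb2 set_empty)
    next
      show "s + size (edges_list K) = 5"
        using k total drops by (simp add: K_def size_edges_list)
      show "edges S + edges_list K \<subseteq># edges w"
        by (simp add: e K_def add.assoc subset_mset.add_mono edges_list_drop)
    qed
  qed
qed

section \<open>Products over walks and matrix powers\<close>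

text \<open>
  An incline need not have a unit to start a product with, so the fold starts with \<open>None\<close> in the
  role of the empty product.
\<close>

definition mset_prod :: "('e \<Rightarrow> 'a::comm_incline) \<Rightarrow> 'e multiset \<Rightarrow> 'a" where
  "mset_prod f M = the (fold_mset (\<lambda>e r. Some (case r of None \<Rightarrow> f e | Some p \<Rightarrow> f e * p)) None M)"

lemma mset_prod_aux:
  fixes f :: "'e \<Rightarrow> 'a::comm_incline"
  shows "fold_mset (\<lambda>e r. Some (case r of None \<Rightarrow> f e | Some p \<Rightarrow> f e * p)) None (add_mset e M)
    = Some (case fold_mset (\<lambda>e r. Some (case r of None \<Rightarrow> f e | Some p \<Rightarrow> f e * p)) None M of
        None \<Rightarrow> f e | Some p \<Rightarrow> f e * p)"
proof -
  interpret comp_fun_commute "\<lambda>e r. Some (case r of None \<Rightarrow> f e | Some p \<Rightarrow> f e * p)"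
    by unfold_locales (auto simp: fun_eq_iff ac_simps split: option.split)
  show ?thesis by simp
qed

lemma mset_prod_single: "mset_prod f {#e#} = f e"
  by (simp add: mset_prod_def mset_prod_aux)

lemma mset_prod_add:
  assumes "M \<noteq> {#}"
  shows "mset_prod f (add_mset e M) = f e * mset_prod f M"
proof -
  obtain e' M' where "M = add_mset e' M'" using assms by (metis multiset_cases)
  then show ?thesis by (simp add: mset_prod_def mset_prod_aux)
qed

lemma mult_le_right: "a * b \<le> (b :: 'a::incline)"
  by (simp add: less_eq_iff_add add.commute absorb_left)

text \<open>
  Each factor that is dropped can only enlarge the product, by absorption; the smaller multiset must
  be nonempty as there is no empty product.
\<close>

lemma mset_prod_antimono:
  assumes "M \<noteq> {#}" "M \<subseteq># N"
  shows "mset_prod f N \<le> mset_prod f M"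
proof -
  have "mset_prod f (M + D) \<le> mset_prod f M" for D
    by (induction D) (use assms(1) in \<open>auto simp: mset_prod_add intro: order_trans mult_le_right\<close>)
  then show ?thesis using assms(2) by (metis subset_mset.add_diff_inverse)
qed

lemma incline_mult_right_mono: "a \<le> b \<Longrightarrow> a * c \<le> b * (c :: 'a::incline)"
  by (metis less_eq_iff_add distrib_right)

lemma incline_add_le_iff: "a + b \<le> c \<longleftrightarrow> a \<le> c \<and> b \<le> (c :: 'a::incline)"
proof
  assume "a + b \<le> c"
  moreover have "a \<le> a + b" "b \<le> a + b"
    unfolding less_eq_iff_add by (metis add.assoc add.commute add_idem)+
  ultimately show "a \<le> c \<and> b \<le> c" by auto
next
  assume "a \<le> c \<and> b \<le> c"
  then show "a + b \<le> c" unfolding less_eq_iff_add by (metis add.assoc)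
qed

lemma incline_sum_le_iff:
  assumes "finite K" "K \<noteq> {}"
  shows "incline_sum f K \<le> c \<longleftrightarrow> (\<forall>k\<in>K. f k \<le> c)"
  using assms by (induction K rule: finite_ne_induct) (simp_all add: incline_add_le_iff)

lemma incline_sum_upper: "finite K \<Longrightarrow> k \<in> K \<Longrightarrow> f k \<le> incline_sum f K"
  using incline_sum_le_iff[of K f "incline_sum f K"] by auto

lemma incline_sum_mult_right:
  assumes "finite K" "K \<noteq> {}"
  shows "incline_sum f K * d = incline_sum (\<lambda>k. f k * d) K"
  using assms by (induction K rule: finite_ne_induct) (simp_all add: distrib_right)

lemma edges_snoc: "w \<noteq> [] \<Longrightarrow> edges (w @ [j]) = add_mset (last w, j) (edges w)"
  by (simp add: edges_append)

abbreviation walk_prod :: "'a::comm_incline ^ 'n ^ 'n \<Rightarrow> 'n list \<Rightarrow> 'a" where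
  "walk_prod A w \<equiv> mset_prod (\<lambda>(i, j). A $ i $ j) (edges w)"

lemma walk_prod_snoc:
  assumes "w \<in> walks i k (Suc n)"
  shows "w @ [j] \<in> walks i j (Suc (Suc n))"
    and "walk_prod A (w @ [j]) = walk_prod A w * A $ k $ j"
proof -
  show "w @ [j] \<in> walks i j (Suc (Suc n))" using assms by (cases w) (auto simp: walks_def)
  have "w \<noteq> []" "last w = k" "edges w \<noteq> {#}"
    using assms by (auto simp: walks_def edges_eq_empty_iff)
  then show "walk_prod A (w @ [j]) = walk_prod A w * A $ k $ j"
    by (simp add: edges_snoc mset_prod_add mult.commute)
qed

lemma pow_step: "incline_mat_pow A (Suc (Suc n)) $ i $ j
    = incline_sum (\<lambda>k. incline_mat_pow A (Suc n) $ i $ k * A $ k $ j) UNIV"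
  by (simp add: incline_mat_mult_def)

text \<open>
  The additional factor \<open>d\<close> is there for the induction: it takes up the last factor \<open>A $ k $ j\<close> of each
  summand of the next power, so that no supremum has to be multiplied.
\<close>

lemma pow_mult_le:
  assumes "\<And>w. w \<in> walks i j (Suc n) \<Longrightarrow> walk_prod A w * d \<le> c"
  shows "incline_mat_pow A (Suc n) $ i $ j * d \<le> c"
  using assms
proof (induction n arbitrary: j d)
  case 0
  have "[i, j] \<in> walks i j (Suc 0)" by (simp add: walks_def)
  from 0[OF this] show ?case by (simp add: mset_prod_single)
next
  case (Suc n)
  have "incline_mat_pow A (Suc n) $ i $ k * A $ k $ j * d \<le> c" for k
    unfolding mult.assoc
  proof (rule Suc.IH)
    fix w assume w: "w \<in> walks i k (Suc n)"
    have "walk_prod A (w @ [j]) * d \<le> c" by (rule Suc.prems[OF walk_prod_snoc(1)[OF w]])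
    then show "walk_prod A w * (A $ k $ j * d) \<le> c"
      by (simp only: walk_prod_snoc(2)[OF w] mult.assoc)
  qed
  then show ?case
    by (simp only: pow_step incline_sum_mult_right incline_sum_le_iff finite UNIV_not_empty
      ball_UNIV simp_thms)
qed

lemma walk_prod_le_pow:
  "w \<in> walks i j (Suc n) \<Longrightarrow> walk_prod A w \<le> incline_mat_pow A (Suc n) $ i $ j"
proof (induction n arbitrary: j w)
  case 0
  then have "w = [i, j]" by (auto simp: walks_def length_Suc_conv)
  then show ?case by (simp add: mset_prod_single)
next
  case (Suc n)
  define k where "k = last (butlast w)"
  have "w \<noteq> []" using Suc.prems by (auto simp: walks_def)
  then have w: "w = butlast w @ [j]"
    using Suc.prems append_butlast_last_id[of w] by (simp add: walks_def)
  have u: "butlast w \<in> walks i k (Suc n)"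
    using Suc.prems by (cases w) (auto simp: walks_def k_def)
  have "walk_prod A w = walk_prod A (butlast w) * A $ k $ j"
    using walk_prod_snoc(2)[OF u, of A j] w by simp
  also have "\<dots> \<le> incline_mat_pow A (Suc n) $ i $ k * A $ k $ j"
    by (intro incline_mult_right_mono Suc.IH u)
  also have "\<dots> \<le> incline_sum (\<lambda>k. incline_mat_pow A (Suc n) $ i $ k * A $ k $ j) UNIV"
    by (rule incline_sum_upper) simp_all
  finally show ?case by (simp only: pow_step)
qed

text \<open>
  The entry of a power is the least upper bound of the products over its walks, which is all that is
  needed of the formula for it as a sum over walks.
\<close>

lemma pow_le_iff_walk_prod_le:
  "incline_mat_pow A (Suc n) $ i $ j \<le> c \<longleftrightarrow> (\<forall>w \<in> walks i j (Suc n). walk_prod A w \<le> c)"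
proof
  assume le: "\<forall>w \<in> walks i j (Suc n). walk_prod A w \<le> c"
  show "incline_mat_pow A (Suc n) $ i $ j \<le> c"
  proof (cases n)
    case 0
    then show ?thesis using le by (auto simp: walks_def mset_prod_single dest: spec[of _ "[i, j]"])
  next
    case (Suc m)
    have "incline_mat_pow A (Suc m) $ i $ k * A $ k $ j \<le> c" for k
    proof (rule pow_mult_le)
      fix w assume w: "w \<in> walks i k (Suc m)"
      show "walk_prod A w * A $ k $ j \<le> c"
        using le walk_prod_snoc(1)[OF w] by (simp add: Suc flip: walk_prod_snoc(2)[OF w])
    qed
    then show ?thesis
      by (simp only: Suc pow_step incline_sum_le_iff finite UNIV_not_empty ball_UNIV simp_thms)
  qed
qed (blast intro: order_trans walk_prod_le_pow)

lemma pow_le_pow_if_contains_walk: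
  fixes A :: "'a::comm_incline ^ 'n ^ 'n"
  assumes "\<And>i j w. w \<in> walks i j (Suc m) \<Longrightarrow>
    \<exists>w' \<in> walks (i :: 'n) j (Suc n). edges w' \<subseteq># edges w"
  shows "incline_mat_pow A (Suc m) \<le> incline_mat_pow A (Suc n)"
proof -
  have "incline_mat_pow A (Suc m) $ i $ j \<le> incline_mat_pow A (Suc n) $ i $ j" for i j
    unfolding pow_le_iff_walk_prod_le
  proof
    fix w assume "w \<in> walks i j (Suc m)"
    then obtain w' where w': "w' \<in> walks i j (Suc n)" "edges w' \<subseteq># edges w"
      using assms by blast
    then have "edges w' \<noteq> {#}" by (auto simp: walks_def edges_eq_empty_iff)
    then have "walk_prod A w \<le> walk_prod A w'" using w'(2) by (rule mset_prod_antimono)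
    also have "\<dots> \<le> incline_mat_pow A (Suc n) $ i $ j" using w'(1) by (rule walk_prod_le_pow)
    finally show "walk_prod A w \<le> incline_mat_pow A (Suc n) $ i $ j" .
  qed
  then show ?thesis by (simp add: less_eq_vec_def)
qed

theorem theorem3p3:
  fixes A :: "'a::comm_incline ^ 3 ^ 3"
  shows "incline_mat_pow A 11 \<le> incline_mat_pow A 5"
  using pow_le_pow_if_contains_walk[of 10 4 A] walk_11_contains_walk_5 by simp

end
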